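(* Let $S$ be a nonempty closed and bounded subset of a Banach space $(\mathcal X,\|\cdot\|)$, and let $\{T_k\}_{k\ge 1}$ be a sequence of mappings such that: (C1) $T_k\in\mathsf B(S)$ for every $k$; (C2) there is a constant $\rho\in[0,1)$, the same for all $k$, such that $\|T_k(x)-T_k(y)\|\le\rho\|x-y\|$ for all $x,y\in S$ and all $k$; let $\mathcal T$ denote the set of all mappings $T\in\mathsf B(S)$ satisfying $\|T(x)-T(y)\|\le\rho\|x-y\|$ for all $x,y\in S$; (C3) there is $T_\infty\in\mathcal T$ such that $T_k$ converges uniformly to $T_\infty$, i.e. $\lim_{k\to\infty}\|T_k-T_\infty\|=0$. Then there exists a unique $x^\star\in S$ satisfying $x^\star=T_\infty(x^\star)$. Moreover, $x^\star$ is independent of the initial value: for every $x_1\in S$, the sequence defined by $x_{k+1}=T_k(x_k)$, $k\ge1$, converges to this same $x^\star$.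
   Context: $\mathsf B(S)$ denotes the set of bounded linear mappings from $S$ into itself: $T:S\to S$ with $T(\lambda x+\mu y)=\lambda T(x)+\mu T(y)$ whenever $\lambda,\mu\in\mathbb R$ and $x,y,\lambda x+\mu y\in S$, and such that there is $M\ge0$ with $\|T(x)\|\le M\|x\|$ for all $x\in S$. The operator norm of a mapping, or of a difference of two such mappings, is $\|T\|=\sup_{x\ne0}\|T(x)\|/\|x\|$, with $x$ ranging over the domain $S$. *)

theory Defs
  imports "HOL-Analysis.Analysis"
begin

(* Mappings S -> S are represented by total functions that send S into S;
   their values outside S are never used. *)

definition bounded_linear_maps :: "'a::real_normed_vector set \<Rightarrow> ('a \<Rightarrow> 'a) set" where
  "bounded_linear_maps S =
     {T. (\<forall>x\<in>S. T x \<in> S) \<and>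
         (\<forall>(a::real) (b::real). \<forall>x\<in>S. \<forall>y\<in>S. a *\<^sub>R x + b *\<^sub>R y \<in> S \<longrightarrow>
            T (a *\<^sub>R x + b *\<^sub>R y) = a *\<^sub>R T x + b *\<^sub>R T y) \<and>
         (\<exists>M\<ge>0. \<forall>x\<in>S. norm (T x) \<le> M * norm x)}"

definition contraction_maps :: "real \<Rightarrow> 'a::real_normed_vector set \<Rightarrow> ('a \<Rightarrow> 'a) set" where
  "contraction_maps \<rho> S =
     {T \<in> bounded_linear_maps S. \<forall>x\<in>S. \<forall>y\<in>S. norm (T x - T y) \<le> \<rho> * norm (x - y)}"

(* As in the library's onorm, the point x = 0 need not be excluded: it contributes the
   value 0 (division by zero), and all quotients are nonnegative. For S = {0} this gives
   the usual convention that the supremum over no points is 0. *)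
definition onorm_on :: "'a::real_normed_vector set \<Rightarrow> ('a \<Rightarrow> 'a) \<Rightarrow> real" where
  "onorm_on S T = (SUP x\<in>S. norm (T x) / norm x)"

end

theory Submission imports Defs begin

text \<open>
  Existence and uniqueness of the fixed point are the contraction principle for \<open>T_inf\<close> on the
  complete set \<open>S\<close>. For the convergence, the iterates are compared with the fixed point
  \<open>x\<^sup>*\<close> of the limit map, not with those of the \<open>T k\<close>: splitting
  \<open>T k (x k) - x\<^sup>*\<close> at \<open>T k x\<^sup>*\<close> gives
  \<open>\<parallel>x (k + 1) - x\<^sup>*\<parallel> \<le> \<rho> * \<parallel>x k - x\<^sup>*\<parallel> + \<parallel>T k - T_inf\<parallel> * \<parallel>x\<^sup>*\<parallel>\<close>.
  So the error obeys a contracting recursion whose perturbation tends to zero, and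
  such an error tends to zero (\<open>perturbed_contraction_tendsto_zero\<close>). The operator norm controls
  the perturbation because the difference of two bounded maps on \<open>S\<close> has bounded quotients
  (\<open>norm_diff_le_onorm_on\<close>).
\<close>

text \<open>
  Once the perturbation is below \<open>(1 - \<rho>) * \<epsilon>\<close>, where \<open>\<epsilon>\<close> is the fixed point of
  \<open>t \<mapsto> \<rho> * t + (1 - \<rho>) * \<epsilon>\<close>, the excess of the error over \<open>\<epsilon>\<close> is
  bounded above by a geometric sequence of ratio \<open>\<rho>\<close>.
\<close>

lemma perturbed_contraction_tendsto_zero:
  fixes a d :: "nat \<Rightarrow> real"
  assumes nonneg: "\<And>k. 0 \<le> a k"
    and rho: "0 \<le> \<rho>" "\<rho> < 1"
    and step: "\<forall>\<^sub>F k in sequentially. a (Suc k) \<le> \<rho> * a k + d k"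
    and d: "d \<longlonglongrightarrow> 0"
  shows "a \<longlonglongrightarrow> 0"
proof (rule order_tendstoI)
  fix y :: real
  assume "y < 0"
  then show "\<forall>\<^sub>F k in sequentially. y < a k"
    using nonneg by (intro always_eventually allI) (rule less_le_trans)
next
  fix y :: real
  assume "0 < y"
  define \<epsilon> where "\<epsilon> = y / 2"
  have eps: "0 < \<epsilon>" "\<epsilon> < y"
    using \<open>0 < y\<close> by (auto simp: \<epsilon>_def)
  have "\<forall>\<^sub>F k in sequentially. d k < (1 - \<rho>) * \<epsilon>"
    using d by (rule order_tendstoD) (use rho eps in simp)
  with step have "\<forall>\<^sub>F k in sequentially. a (Suc k) - \<epsilon> \<le> \<rho> * (a k - \<epsilon>)"
    by eventually_elim (simp add: algebra_simps)
  then obtain N where N: "\<And>k. N \<le> k \<Longrightarrow> a (Suc k) - \<epsilon> \<le> \<rho> * (a k - \<epsilon>)"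
    by (auto simp: eventually_sequentially)
  have geometric: "a (n + N) - \<epsilon> \<le> \<rho> ^ n * (a N - \<epsilon>)" for n
  proof (induction n)
    case 0
    show ?case by simp
  next
    case (Suc n)
    have "a (Suc n + N) - \<epsilon> \<le> \<rho> * (a (n + N) - \<epsilon>)"
      using N[of "n + N"] by simp
    also have "\<dots> \<le> \<rho> * (\<rho> ^ n * (a N - \<epsilon>))"
      using Suc.IH rho(1) by (rule mult_left_mono)
    finally show ?case by (simp add: mult.assoc)
  qed
  have "(\<lambda>n. \<rho> ^ n * (a N - \<epsilon>)) \<longlonglongrightarrow> 0"
    using rho by (intro tendsto_mult_left_zero LIMSEQ_power_zero) simp
  then have "\<forall>\<^sub>F n in sequentially. \<rho> ^ n * (a N - \<epsilon>) < y - \<epsilon>"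
    by (rule order_tendstoD) (use eps in simp)
  then have "\<forall>\<^sub>F n in sequentially. a (n + N) < y"
  proof eventually_elim
    case (elim n)
    then show ?case using geometric[of n] by linarith
  qed
  then show "\<forall>\<^sub>F k in sequentially. a k < y"
    by (subst (asm) eventually_sequentially_seg)
qed

text \<open>
  The supremum \<open>onorm_on\<close> of a set of reals is an upper bound only if that set is bounded above;
  the sum of the two bounds bounds the quotients of the difference.
\<close>

lemma norm_diff_le_onorm_on:
  assumes F: "F \<in> bounded_linear_maps S" and G: "G \<in> bounded_linear_maps S" and x: "x \<in> S"
  shows "norm (F x - G x) \<le> onorm_on S (\<lambda>x. F x - G x) * norm x"
proof -
  obtain M where M: "0 \<le> M" "\<And>z. z \<in> S \<Longrightarrow> norm (F z) \<le> M * norm z"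
    using F by (auto simp: bounded_linear_maps_def)
  obtain M' where M': "0 \<le> M'" "\<And>z. z \<in> S \<Longrightarrow> norm (G z) \<le> M' * norm z"
    using G by (auto simp: bounded_linear_maps_def)
  have bound: "norm (F z - G z) \<le> (M + M') * norm z" if "z \<in> S" for z
    using norm_triangle_ineq4[of "F z" "G z"] M(2)[OF that] M'(2)[OF that]
    by (simp add: distrib_right)
  have "norm (F z - G z) / norm z \<le> M + M'" if "z \<in> S" for z
    using bound[OF that] M(1) M'(1) by (cases "z = 0") (auto simp: divide_simps)
  then have "bdd_above ((\<lambda>z. norm (F z - G z) / norm z) ` S)"
    by (rule bdd_aboveI2)
  then have quotient: "norm (F x - G x) / norm x \<le> onorm_on S (\<lambda>x. F x - G x)"
    unfolding onorm_on_def using x by (intro cSUP_upper)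
  show ?thesis
  proof (cases "x = 0")
    case True
    then show ?thesis using bound[OF x] by simp
  next
    case False
    then show ?thesis using quotient by (simp add: divide_simps)
  qed
qed

theorem mainTheorem1:
  fixes S :: "'a::banach set"
    and T :: "nat \<Rightarrow> 'a \<Rightarrow> 'a"
    and T_inf :: "'a \<Rightarrow> 'a"
    and \<rho> :: real
  assumes "S \<noteq> {}" and "closed S" and "bounded S"
    and C1: "\<And>k. k \<ge> 1 \<Longrightarrow> T k \<in> bounded_linear_maps S"
    and rho: "0 \<le> \<rho>" "\<rho> < 1"
    and C2: "\<And>k x y. k \<ge> 1 \<Longrightarrow> x \<in> S \<Longrightarrow> y \<in> S \<Longrightarrow> norm (T k x - T k y) \<le> \<rho> * norm (x - y)"
    and C3: "T_inf \<in> contraction_maps \<rho> S"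
      "(\<lambda>k. onorm_on S (\<lambda>x. T k x - T_inf x)) \<longlonglongrightarrow> 0"
  shows "(\<exists>!xstar. xstar \<in> S \<and> xstar = T_inf xstar) \<and>
    (\<forall>xstar\<in>S. xstar = T_inf xstar \<longrightarrow>
       (\<forall>x :: nat \<Rightarrow> 'a. x 1 \<in> S \<and> (\<forall>k\<ge>1. x (k + 1) = T k (x k)) \<longrightarrow> x \<longlonglongrightarrow> xstar))"
proof (intro conjI ballI allI impI)
  have T_inf: "T_inf \<in> bounded_linear_maps S"
    and contr: "\<And>x y. x \<in> S \<Longrightarrow> y \<in> S \<Longrightarrow> dist (T_inf x) (T_inf y) \<le> \<rho> * dist x y"
    using C3(1) by (simp_all add: contraction_maps_def dist_norm)
  have "T_inf ` S \<subseteq> S"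
    using T_inf by (auto simp: bounded_linear_maps_def)
  then have "\<exists>!x\<in>S. T_inf x = x"
    by (intro Banach_fix[OF _ \<open>S \<noteq> {}\<close> rho _ contr]) (simp_all add: \<open>closed S\<close> complete_eq_closed)
  then show "\<exists>!xstar. xstar \<in> S \<and> xstar = T_inf xstar"
    by metis

  fix xstar :: 'a and x :: "nat \<Rightarrow> 'a"
  assume xstar: "xstar \<in> S" "xstar = T_inf xstar"
    and x: "x 1 \<in> S \<and> (\<forall>k\<ge>1. x (k + 1) = T k (x k))"
  have mem: "x k \<in> S" if "1 \<le> k" for k
    using that
  proof (induction k rule: dec_induct)
    case base
    show ?case using x by simp
  next
    case (step k)
    then have "T k (x k) \<in> S"
      using C1[of k] by (simp add: bounded_linear_maps_def)
    then show ?case using x step.hyps(1) by simp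
  qed
  define d where "d = (\<lambda>k. onorm_on S (\<lambda>x. T k x - T_inf x) * norm xstar)"
  have error: "norm (x (Suc k) - xstar) \<le> \<rho> * norm (x k - xstar) + d k" if "1 \<le> k" for k
  proof -
    have "x (Suc k) - xstar = (T k (x k) - T k xstar) + (T k xstar - T_inf xstar)"
      using x that xstar(2)[symmetric] by simp
    also have "norm \<dots> \<le> norm (T k (x k) - T k xstar) + norm (T k xstar - T_inf xstar)"
      by (rule norm_triangle_ineq)
    also have "\<dots> \<le> \<rho> * norm (x k - xstar) + d k"
      unfolding d_def
      by (intro add_mono norm_diff_le_onorm_on C1 C2 that mem xstar(1) T_inf)
    finally show ?thesis .
  qed
  have "d \<longlonglongrightarrow> 0"
    unfolding d_def using C3(2) by (rule tendsto_mult_left_zero)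
  then have "(\<lambda>k. norm (x k - xstar)) \<longlonglongrightarrow> 0"
    using eventually_sequentiallyI[OF error]
    by (intro perturbed_contraction_tendsto_zero[OF norm_ge_zero rho])
  then show "x \<longlonglongrightarrow> xstar"
    by (simp add: tendsto_norm_zero_iff LIM_zero_iff)
qed

end
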